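(* Suppose that $\mathcal Y,\mathcal X,\mathcal U$ are measurable spaces, that for each $\theta\in\Theta$ the set $\Gamma_\theta$ of admissible input measures is defined by moment equalities and inequalities as in the context, that for each $\theta\in\Theta$ the output operator $L_\theta$ is induced by a probability kernel $K_\theta$ as in the context, and that for each $\theta\in\Theta$ there exists a $\sigma$-finite measure $\lambda_\theta$ on $\mathcal Z$ such that $L_\theta\gamma$ is absolutely continuous with respect to $\lambda_\theta$ for every $\gamma\in\Gamma_\theta$. Let $\mu^*\in\mathcal P(\mathcal Z)$. Then $$\{\theta\in\Theta:\ \mu^*\in\overline{\mathcal M}_\theta\}=\{\theta\in\Theta:\ T(\theta)=0\},$$ that is, the identified set equals the zero set of the adversarial discrepancy function $T$.
   Context: Let $\mathcal W=\mathcal X\times\mathcal U$ (inputs $W=(X,U)$) and $\mathcal Z=\mathcal Y\times\mathcal X$ (outputs $Z=(Y,X)$), with product $\sigma$-algebras. $\mathcal P(\mathcal S)$ denotes the set of probability measures on a measurable space $\mathcal S$. $\Theta$ is a set of parameters. Admissible input measures: for each $\theta\in\Theta$, $$\Gamma_\theta=\{\gamma\in\mathcal P(\mathcal W):\ \mathbb E_\gamma[g_{1,j}(W;\theta)]=0\ \forall j\in\mathcal J,\ \ \mathbb E_\gamma[g_{2,k}(W;\theta)]\le0\ \forall k\in\mathcal K\},$$ where $\mathcal J,\mathcal K$ are arbitrary index sets and $g_{1,j}(\cdot;\theta),g_{2,k}(\cdot;\theta)$ are real-valued measurable functions on $\mathcal W$; membership in $\Gamma_\theta$ implicitly requires that all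 these functions be $\gamma$-integrable. Output operator: for each $\theta$, $K_\theta(\cdot\mid\cdot)$ is a probability kernel from $\mathcal W$ to $\mathcal Z$ (not depending on $\gamma$) such that the pushforward of $K_\theta(\cdot\mid x,u)$ under the projection $\mathcal Z\to\mathcal X$ is the Dirac measure $\delta_x$, for all $(x,u)\in\mathcal W$. Define $(L_\theta\gamma)(B)=\int_{\mathcal W}K_\theta(B\mid w)\,d\gamma(w)$ for measurable $B\subseteq\mathcal Z$. Total variation distance: $\|\mu-\mu'\|_{\mathrm{TV}}=\sup_B|\mu(B)-\mu'(B)|$, the supremum being over measurable sets $B$. Let $$\overline{\mathcal M}_\theta=\{m\in\mathcal P(\mathcal Z):\ \forall\epsilon>0\ \exists\gamma\in\Gamma_\theta\text{ with }\|L_\theta\gamma-m\|_{\mathrm{TV}}<\epsilon\},$$ the TV closure of $\mathcal M_\theta=\{L_\theta\gamma:\gamma\in\Gamma_\theta\}$. The identified set is $\{\theta\in\Theta:\mu^*\in\overline{\mathcal M}_\theta\}$. Adversarial discrepancy function: with $\Phi(\mathcal Z)=\{\phi:\mathcal Z\to[0,1]\text{ measurable}\}$, $$T(\theta)=\sup_{\phi\in\Phi(\mathcal Z)}\ \inf_{\gamma\in\Gamma_\theta}\bigl(\mathbb E_{\mu^*}[\phi]-\mathbb E_{L_\theta\gamma}[\phi]\bigr),$$ with the convention $\inf\varnothing=+\infty$. *)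

theory Defs
  imports "HOL-Probability.Probability"
begin

text \<open>
  \<^term>\<open>space (prob_algebra M)\<close> is the set of probability measures on the measurable space M.
\<close>

text \<open>
  The integrals in the moment conditions are Bochner integrals, which are 0 for non-integrable
  functions; integrability is therefore required explicitly.
\<close>

definition admissible_inputs ::
  "'w measure \<Rightarrow> 'j set \<Rightarrow> 'k set \<Rightarrow> ('j \<Rightarrow> 'w \<Rightarrow> real) \<Rightarrow> ('k \<Rightarrow> 'w \<Rightarrow> real) \<Rightarrow> 'w measure set"
where
  "admissible_inputs W J K g1 g2 =
     {\<gamma> \<in> space (prob_algebra W).
        (\<forall>j\<in>J. integrable \<gamma> (g1 j) \<and> (\<integral>w. g1 j w \<partial>\<gamma>) = 0) \<and>
        (\<forall>k\<in>K. integrable \<gamma> (g2 k) \<and> (\<integral>w. g2 k w \<partial>\<gamma>) \<le> 0)}"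

definition output_operator :: "('w \<Rightarrow> 'z measure) \<Rightarrow> 'w measure \<Rightarrow> 'z measure" where
  "output_operator \<kappa> \<gamma> = \<gamma> \<bind> \<kappa>"

lemma emeasure_output_operator:
  assumes "\<gamma> \<in> space (prob_algebra W)" "\<kappa> \<in> W \<rightarrow>\<^sub>M prob_algebra Z" "B \<in> sets Z"
  shows "emeasure (output_operator \<kappa> \<gamma>) B = (\<integral>\<^sup>+w. emeasure (\<kappa> w) B \<partial>\<gamma>)"
  unfolding output_operator_def using assms by (rule emeasure_bind_prob_algebra)

lemma output_operator_in_prob_algebra:
  assumes "\<gamma> \<in> space (prob_algebra W)" "\<kappa> \<in> W \<rightarrow>\<^sub>M prob_algebra Z"
  shows "output_operator \<kappa> \<gamma> \<in> space (prob_algebra Z)"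
  unfolding output_operator_def
  using prob_space_bind'[OF assms] sets_bind'[OF assms] by (simp add: space_prob_algebra)

text \<open>Meaningful for measures on the common measurable space Z.\<close>

definition tv_dist :: "'z measure \<Rightarrow> 'z measure \<Rightarrow> 'z measure \<Rightarrow> real" where
  "tv_dist Z \<mu> \<nu> = (SUP B\<in>sets Z. \<bar>measure \<mu> B - measure \<nu> B\<bar>)"

text \<open>
  \<^term>\<open>Sup\<close> on the reals is only meaningful for nonempty sets that are bounded above, which holds here.
\<close>

lemma tv_dist_bdd_above:
  assumes "\<mu> \<in> space (prob_algebra Z)" "\<nu> \<in> space (prob_algebra Z)"
  shows "bdd_above ((\<lambda>B. \<bar>measure \<mu> B - measure \<nu> B\<bar>) ` sets Z)"
proof (rule bdd_aboveI2)
  fix B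
  have "prob_space \<mu>" "prob_space \<nu>"
    using assms by (simp_all add: space_prob_algebra)
  then have "measure \<mu> B \<le> 1" "measure \<nu> B \<le> 1"
    by (simp_all add: prob_space.prob_le_1)
  moreover have "0 \<le> measure \<mu> B" "0 \<le> measure \<nu> B"
    by simp_all
  ultimately show "\<bar>measure \<mu> B - measure \<nu> B\<bar> \<le> 1"
    by linarith
qed

definition tv_closure :: "'z measure \<Rightarrow> 'z measure set \<Rightarrow> 'z measure set" where
  "tv_closure Z S = {m \<in> space (prob_algebra Z). \<forall>\<epsilon>>0. \<exists>\<nu>\<in>S. tv_dist Z \<nu> m < \<epsilon>}"

definition test_functions :: "'z measure \<Rightarrow> ('z \<Rightarrow> real) set" where
  "test_functions Z = {\<phi> \<in> borel_measurable Z. \<forall>z\<in>space Z. \<phi> z \<in> {0..1}}"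

text \<open>
  Formed in the extended reals, so that the infimum over an empty set of input measures is
  \<^term>\<open>\<infinity> :: ereal\<close>.
\<close>

definition adversarial_discrepancy ::
  "'z measure \<Rightarrow> 'z measure \<Rightarrow> 'w measure set \<Rightarrow> ('w measure \<Rightarrow> 'z measure) \<Rightarrow> ereal"
where
  "adversarial_discrepancy Z \<mu> \<Gamma> L =
     (SUP \<phi>\<in>test_functions Z. INF \<gamma>\<in>\<Gamma>. ereal ((\<integral>z. \<phi> z \<partial>\<mu>) - (\<integral>z. \<phi> z \<partial>L \<gamma>)))"

end

theory Submission
  imports Defs
begin

text \<open>
  If \<open>\<mu>\<close> is in the closure, \<open>T = 0\<close> because the difference of the expectations of a test function is
  at most the total variation distance. For the converse, all output measures and \<open>\<mu>\<close> have
  densities with respect to one finite measure \<open>\<rho>\<close>, and the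
  differences \<open>g\<close> between the density of \<open>\<mu>\<close> and that of an output measure form a convex set \<open>S\<close>.
  If \<open>\<mu>\<close> is at positive total variation distance from all outputs, a single test function has to be
  found that works for all \<open>g \<in> S\<close>. Instead of invoking a minimax theorem, minimise
  \<open>F g = \<integral> huber (g x) d\<rho>\<close> over \<open>S\<close>, where
  \<open>huber x = max {p x - p\<^sup>2 / 2 | 0 \<le> p \<le> 1}\<close> is a smoothed positive part whose derivative \<open>clip\<close>
  takes values in \<open>[0, 1]\<close>. The infimum is positive but need not be attained. Strong convexity of the dual
  penalty \<open>p\<^sup>2 / 2\<close> however makes \<open>clip (g\<^sub>n x)\<close> Cauchy in \<open>L\<^sup>2(\<rho>)\<close> along a minimising
  sequence, and its limit \<open>\<phi>\<close> satisfies \<open>\<integral> \<phi> g d\<rho> \<ge> inf F\<close> for every \<open>g \<in> S\<close>.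
\<close>

section \<open>Clipping and the smoothed positive part\<close>

definition clip :: "real \<Rightarrow> real" where
  "clip x = max 0 (min 1 x)"

text \<open>In closed form this is 0 below 0, \<open>x\<^sup>2 / 2\<close> on [0, 1] and
  \<open>x - 1/2\<close> above 1. Writing it through the maximiser \<open>clip x\<close> reduces
  comparisons with other multipliers \<open>p\<close> to algebra.\<close>

definition huber :: "real \<Rightarrow> real" where
  "huber x = clip x * x - (clip x)\<^sup>2 / 2"

lemma clip_bounds: "0 \<le> clip x" "clip x \<le> 1"
  by (auto simp: clip_def)

lemma borel_measurable_clip [measurable]: "clip \<in> borel_measurable borel"
  unfolding clip_def by measurable

lemma borel_measurable_huber [measurable]: "huber \<in> borel_measurable borel"
  unfolding huber_def by measurable

text \<open>\<open>clip x\<close> is the projection of \<open>x\<close> onto [0, 1], so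
  \<open>(clip x - p) * (x - clip x)\<close> is nonnegative for every \<open>p\<close> in that
  interval. This product is exactly the right side minus the left side; the quadratic surplus comes
  from the strong convexity of the penalty.\<close>

lemma huber_ge:
  assumes "0 \<le> p" "p \<le> 1"
  shows "p * x - p\<^sup>2 / 2 + (clip x - p)\<^sup>2 / 2 \<le> huber x"
proof -
  have "0 \<le> (clip x - p) * (x - clip x)"
    using assms by (auto simp: clip_def max_def min_def mult_nonneg_nonpos intro: mult_nonneg_nonneg mult_nonpos_nonpos)
  then show ?thesis
    by (simp add: huber_def power2_eq_square field_simps)
qed

text \<open>For \<open>p = clip y\<close> the left side is the tangent of \<open>huber\<close> at
  \<open>y\<close>, so this also serves as the gradient inequality.\<close>

lemma huber_ge_affine:
  assumes "0 \<le> p" "p \<le> 1"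
  shows "p * x - p\<^sup>2 / 2 \<le> huber x"
proof -
  have "0 \<le> (clip x - p)\<^sup>2 / 2" by simp
  then show ?thesis
    using huber_ge[OF assms, of x] by linarith
qed

lemma huber_nonneg: "0 \<le> huber x"
  using huber_ge_affine[of 0 x] by simp

lemma huber_le: "huber x \<le> clip x * x"
  by (simp add: huber_def)

lemma abs_huber_le: "\<bar>huber x\<bar> \<le> \<bar>x\<bar>"
proof -
  have "clip x * x \<le> clip x * \<bar>x\<bar>"
    using clip_bounds[of x] by (intro mult_left_mono) auto
  also have "\<dots> \<le> \<bar>x\<bar>"
    using clip_bounds[of x] by (intro mult_left_le_one_le) auto
  finally have "clip x * x \<le> \<bar>x\<bar>" .
  then show ?thesis
    using huber_nonneg[of x] huber_le[of x] by linarith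
qed

text \<open>A supremum of affine functions is convex: the multiplier that is optimal at the
  combination is tested at both end points.\<close>

lemma huber_convex:
  assumes "0 \<le> t" "t \<le> 1"
  shows "huber ((1 - t) * a + t * b) \<le> (1 - t) * huber a + t * huber b"
proof -
  define q where "q = (1 - t) * a + t * b"
  define p where "p = clip q"
  have "p * x - p\<^sup>2 / 2 \<le> huber x" for x
    by (simp add: huber_ge_affine p_def clip_bounds)
  then have "(1 - t) * (p * a - p\<^sup>2 / 2) + t * (p * b - p\<^sup>2 / 2) \<le> (1 - t) * huber a + t * huber b"
    using assms by (intro add_mono mult_left_mono) auto
  then show ?thesis
    unfolding q_def[symmetric] huber_def[of q] p_def[symmetric] by (simp add: q_def field_simps)
qed

text \<open>The multiplier that is optimal at the midpoint is tested at \<open>a\<close> and at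
  \<open>b\<close>; the two quadratic surpluses of \<open>huber_ge\<close> together control the
  distance of \<open>clip a\<close> from \<open>clip b\<close>. The midpoint is spelled as a convex
  combination with weight 1/2, the form in which convexity of a set of functions is assumed
  below.\<close>

lemma huber_midpoint:
  "(clip a - clip b)\<^sup>2 \<le> 4 * (huber a + huber b - 2 * huber ((1 - 1/2) * a + 1/2 * b))"
proof -
  define q where "q = (1 - 1/2) * a + 1/2 * b"
  define p where "p = clip q"
  have p: "0 \<le> p" "p \<le> 1"
    by (simp_all add: p_def clip_bounds)
  have "2 * huber q = p * a + p * b - p\<^sup>2"
    unfolding huber_def[of q] p_def[symmetric] by (simp add: q_def algebra_simps)
  moreover have "(clip a - clip b)\<^sup>2 \<le> 2 * ((clip a - p)\<^sup>2 + (clip b - p)\<^sup>2)"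
    using zero_le_power2[of "clip a + clip b - 2 * p"] by (simp add: power2_eq_square algebra_simps)
  ultimately show ?thesis
    using huber_ge[OF p, of a] huber_ge[OF p, of b] unfolding q_def[symmetric] by (simp add: field_simps)
qed

section \<open>Almost everywhere convergence from summable integrals\<close>

lemma AE_summable_of_summable_integral:
  fixes u :: "nat \<Rightarrow> 'a \<Rightarrow> real"
  assumes int: "\<And>n. integrable M (u n)" and nonneg: "\<And>n x. 0 \<le> u n x"
    and sum: "summable (\<lambda>n. \<integral>x. u n x \<partial>M)"
  shows "AE x in M. summable (\<lambda>n. u n x)"
proof -
  have [measurable]: "u n \<in> borel_measurable M" for n
    using int by auto
  have "(\<integral>\<^sup>+x. (\<Sum>n. ennreal (u n x)) \<partial>M) = (\<Sum>n. \<integral>\<^sup>+x. ennreal (u n x) \<partial>M)"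
    by (intro nn_integral_suminf) measurable
  also have "\<dots> = (\<Sum>n. ennreal (\<integral>x. u n x \<partial>M))"
    using int nonneg by (simp add: nn_integral_eq_integral)
  also have "\<dots> = ennreal (\<Sum>n. \<integral>x. u n x \<partial>M)"
    using sum nonneg by (intro suminf_ennreal2) (auto intro: integral_nonneg)
  finally have "(\<integral>\<^sup>+x. (\<Sum>n. ennreal (u n x)) \<partial>M) \<noteq> \<infinity>"
    by simp
  then have "AE x in M. (\<Sum>n. ennreal (u n x)) \<noteq> \<infinity>"
    by (intro nn_integral_PInf_AE) measurable
  then show ?thesis
    by eventually_elim (auto intro: summable_suminf_not_top nonneg)
qed

lemma summable_integral_of_le:
  fixes u :: "nat \<Rightarrow> 'a \<Rightarrow> real"
  assumes "\<And>n. (\<integral>x. u n x \<partial>M) \<le> b n" "summable b" "\<And>n x. 0 \<le> u n x"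
  shows "summable (\<lambda>n. \<integral>x. u n x \<partial>M)"
  using assms(2)
  by (rule summable_comparison_test[OF exI[of _ 0], rotated]) (simp add: assms(1,3))

text \<open>An increment either is at most \<open>(1/2) ^ n\<close> or is bounded by
  \<open>2 ^ n\<close> times its own square, so the increments are absolutely summable. This turns a
  fast L2 rate into pointwise convergence of the whole sequence, not just of a subsequence.\<close>

lemma convergent_of_summable_scaled_squares:
  fixes u :: "nat \<Rightarrow> real"
  assumes "summable (\<lambda>n. 2 ^ n * (u (Suc n) - u n)\<^sup>2)"
  shows "convergent u"
proof -
  have le: "norm (u (Suc n) - u n) \<le> (1/2) ^ n + 2 ^ n * (u (Suc n) - u n)\<^sup>2" for n
  proof -
    define d where "d = \<bar>u (Suc n) - u n\<bar>"
    have "0 \<le> d" by (simp add: d_def)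
    show ?thesis
    proof (cases "d \<le> (1/2) ^ n")
      case True
      then show ?thesis by (simp add: d_def add_increasing2)
    next
      case False
      then have "1 \<le> 2 ^ n * d"
        by (simp add: field_simps)
      then have "d * 1 \<le> d * (2 ^ n * d)"
        using \<open>0 \<le> d\<close> by (rule mult_left_mono)
      also have "\<dots> = 2 ^ n * (u (Suc n) - u n)\<^sup>2"
        by (simp add: d_def power2_eq_square)
      finally show ?thesis
        by (simp add: d_def add_increasing)
    qed
  qed
  have "summable (\<lambda>n. (1/2::real) ^ n + 2 ^ n * (u (Suc n) - u n)\<^sup>2)"
    using assms by (intro summable_add summable_geometric) auto
  then have "summable (\<lambda>n. u (Suc n) - u n)"
    by (rule summable_comparison_test'[of _ 0]) (rule le)
  then have "convergent (\<lambda>n. u n - u 0)"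
    by (simp only: summable_iff_convergent sum_lessThan_telescope)
  then show ?thesis
    by (simp only: convergent_diff_const_right_iff)
qed

section \<open>Minimising the smoothed functional over a convex set\<close>

context finite_measure
begin

lemma integrable_huber:
  assumes "integrable M g"
  shows "integrable M (\<lambda>x. huber (g x))"
proof -
  have [measurable]: "g \<in> borel_measurable M" using assms by auto
  show ?thesis
    by (rule Bochner_Integration.integrable_bound[OF assms]) (auto simp: abs_huber_le)
qed

lemma integrable_unit_mult:
  fixes g \<phi> :: "'a \<Rightarrow> real"
  assumes "integrable M g" "\<phi> \<in> borel_measurable M" "\<And>x. x \<in> space M \<Longrightarrow> 0 \<le> \<phi> x" "\<And>x. x \<in> space M \<Longrightarrow> \<phi> x \<le> 1"
  shows "integrable M (\<lambda>x. \<phi> x * g x)"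
proof -
  have [measurable]: "g \<in> borel_measurable M" using assms by auto
  note [measurable] = assms(2)
  show ?thesis
    by (rule Bochner_Integration.integrable_bound[OF assms(1)])
      (auto simp: abs_mult assms(3,4) intro!: mult_left_le_one_le)
qed

lemma integrable_clip_diff_sq:
  assumes [measurable]: "g \<in> borel_measurable M" "h \<in> borel_measurable M"
  shows "integrable M (\<lambda>x. (clip (g x) - clip (h x))\<^sup>2)"
proof (rule integrable_const_bound[of _ 1])
  have "\<bar>clip a - clip b\<bar> \<le> 1" for a b
    by (auto simp: clip_def)
  then show "AE x in M. norm ((clip (g x) - clip (h x))\<^sup>2) \<le> 1"
    by (simp add: abs_square_le_1)
qed measurable

text \<open>By \<open>lower\<close> each \<open>g\<close> has a good test function of its own,
  namely \<open>clip\<close> applied to \<open>g\<close>; the conclusion provides a common one. At a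
  minimiser \<open>G\<close> of the functional, the first-order condition says that the integral of
  \<open>clip (G x) * (g x - G x)\<close> is nonnegative, and \<open>clip (G x)\<close> would do
  because of \<open>huber_le\<close>. The proof carries this argument through along
  near-minimisers.\<close>

proposition uniform_test_function:
  fixes S :: "('a \<Rightarrow> real) set"
  assumes "S \<noteq> {}" and int: "\<And>g. g \<in> S \<Longrightarrow> integrable M g"
    and conv: "\<And>g h t. g \<in> S \<Longrightarrow> h \<in> S \<Longrightarrow> 0 \<le> t \<Longrightarrow> t \<le> 1 \<Longrightarrow> (\<lambda>x. (1 - t) * g x + t * h x) \<in> S"
    and lower: "\<And>g. g \<in> S \<Longrightarrow> m\<^sub>0 \<le> (\<integral>x. huber (g x) \<partial>M)"
  obtains \<phi> where "\<phi> \<in> borel_measurable M" "\<And>x. 0 \<le> \<phi> x" "\<And>x. \<phi> x \<le> 1"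
    "\<And>g. g \<in> S \<Longrightarrow> m\<^sub>0 \<le> (\<integral>x. \<phi> x * g x \<partial>M)"
proof -
  define F where "F g = (\<integral>x. huber (g x) \<partial>M)" for g
  define m where "m = (INF g\<in>S. F g)"
  have bdd: "bdd_below (F ` S)"
    using lower by (auto simp: F_def bdd_below_def)
  have m_le: "m \<le> F g" if "g \<in> S" for g
    unfolding m_def using that bdd by (rule cINF_lower[rotated])
  have m0: "m\<^sub>0 \<le> m"
    unfolding m_def using \<open>S \<noteq> {}\<close> lower by (intro cINF_greatest) (auto simp: F_def)
  have meas: "g \<in> borel_measurable M" if "g \<in> S" for g
    using int[OF that] by auto
  have F_conv: "F (\<lambda>x. (1 - t) * g x + t * h x) \<le> (1 - t) * F g + t * F h"
    if "g \<in> S" "h \<in> S" "0 \<le> t" "t \<le> 1" for g h t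
  proof -
    have "F (\<lambda>x. (1 - t) * g x + t * h x) \<le> (\<integral>x. (1 - t) * huber (g x) + t * huber (h x) \<partial>M)"
      unfolding F_def using that int conv
      by (intro integral_mono integrable_huber huber_convex Bochner_Integration.integrable_add integrable_mult_right) auto
    also have "\<dots> = (1 - t) * F g + t * F h"
      unfolding F_def using that int integrable_huber by simp
    finally show ?thesis .
  qed
  \<comment> \<open>The midpoint of \<open>g\<close> and \<open>h\<close> stays in \<open>S\<close>,
    so its value is at least \<open>m\<close>. Hence the L2 distance of the clipped functions is
    controlled by how far \<open>F g\<close> and \<open>F h\<close> exceed \<open>m\<close>.\<close>
  have L2: "(\<integral>x. (clip (g x) - clip (h x))\<^sup>2 \<partial>M) \<le> 4 * (F g + F h - 2 * m)"
    if "g \<in> S" "h \<in> S" for g h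
  proof -
    let ?k = "\<lambda>x. (1 - 1/2) * g x + 1/2 * h x"
    have k: "?k \<in> S" using that by (intro conv) auto
    have "(\<integral>x. (clip (g x) - clip (h x))\<^sup>2 \<partial>M)
        \<le> (\<integral>x. 4 * (huber (g x) + huber (h x) - 2 * huber (?k x)) \<partial>M)"
      using that int k meas
      by (intro integral_mono huber_midpoint integrable_clip_diff_sq integrable_mult_right
          Bochner_Integration.integrable_diff Bochner_Integration.integrable_add integrable_huber) auto
    also have "\<dots> = 4 * (F g + F h - 2 * F ?k)"
      unfolding F_def using that int integrable_huber[OF int[OF k]] integrable_huber by simp
    also have "\<dots> \<le> 4 * (F g + F h - 2 * m)"
      using m_le[OF k] by simp
    finally show ?thesis .
  qed
  \<comment> \<open>The rate is fast enough to remain summable both after weighting by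
    \<open>2 ^ n\<close> and after taking a square root.\<close>
  have "\<exists>g\<in>S. F g < m + (1/16) ^ n" for n
    using cINF_less_iff[OF \<open>S \<noteq> {}\<close> bdd, of "m + (1/16) ^ n"] by (simp add: m_def)
  then obtain G where G: "\<And>n. G n \<in> S" "\<And>n. F (G n) < m + (1/16) ^ n"
    by metis
  have [measurable]: "G n \<in> borel_measurable M" for n
    using G meas by blast
  have "AE x in M. summable (\<lambda>n. 2 ^ n * (clip (G (Suc n) x) - clip (G n x))\<^sup>2)"
  proof (rule AE_summable_of_summable_integral)
    have "(\<integral>x. 2 ^ n * (clip (G (Suc n) x) - clip (G n x))\<^sup>2 \<partial>M) \<le> 8 * (1/8) ^ n" for n
    proof -
      \<comment> \<open>With both slacks below \<open>(1/16) ^ n\<close>, the bound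
        \<open>L2\<close> yields the constant 4 * 2 = 8.\<close>
      have "F (G (Suc n)) < m + (1/16) ^ n"
        using G(2)[of "Suc n"] by (rule less_le_trans) (intro add_left_mono power_decreasing, auto)
      then have "(\<integral>x. (clip (G (Suc n) x) - clip (G n x))\<^sup>2 \<partial>M) \<le> 8 * (1/16) ^ n"
        using L2[OF G(1)[of "Suc n"] G(1)[of n]] G(2)[of n] by argo
      then have "2 ^ n * (\<integral>x. (clip (G (Suc n) x) - clip (G n x))\<^sup>2 \<partial>M) \<le> 2 ^ n * (8 * (1/16) ^ n)"
        by (intro mult_left_mono) auto
      also have "\<dots> = 8 * (1/8) ^ n"
        by (simp add: power_mult_distrib[symmetric] mult.left_commute)
      finally show ?thesis by simp
    qed
    then show "summable (\<lambda>n. \<integral>x. 2 ^ n * (clip (G (Suc n) x) - clip (G n x))\<^sup>2 \<partial>M)"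
      by (rule summable_integral_of_le) (intro summable_mult summable_geometric, auto)
  qed (auto intro!: integrable_mult_right integrable_clip_diff_sq)
  then have AE_lim: "AE x in M. convergent (\<lambda>n. clip (G n x))"
    by eventually_elim (rule convergent_of_summable_scaled_squares)
  \<comment> \<open>Where the sequence diverges, \<open>lim\<close> is an unspecified real. The
    outer \<open>clip\<close> forces values in [0, 1] everywhere and changes nothing where the
    sequence converges, since the limit lies in [0, 1] already.\<close>
  define \<phi> where "\<phi> x = clip (lim (\<lambda>n. clip (G n x)))" for x
  have phi_lim: "AE x in M. (\<lambda>n. clip (G n x)) \<longlonglongrightarrow> \<phi> x"
    using AE_lim
  proof eventually_elim
    case (elim x)
    then obtain l where l: "(\<lambda>n. clip (G n x)) \<longlonglongrightarrow> l"
      by (auto simp: convergent_def)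
    have "0 \<le> l" "l \<le> 1"
      using l by (auto intro: LIMSEQ_le_const LIMSEQ_le_const2 clip_bounds)
    then have "clip l = l" by (simp add: clip_def)
    with l show ?case by (simp add: \<phi>_def limI)
  qed
  have phi_meas [measurable]: "\<phi> \<in> borel_measurable M"
    unfolding \<phi>_def by measurable
  have "m \<le> (\<integral>x. \<phi> x * g x \<partial>M)" if "g \<in> S" for g
  proof -
    have [measurable]: "g \<in> borel_measurable M" using that meas by blast
    \<comment> \<open>Moving \<open>G n\<close> towards \<open>g\<close> by \<open>t n = (1/4)^n\<close>, the square root of the slack \<open>(1/16)^n\<close>, gives a
      sequence that is still minimising, so it has the same limit \<open>\<phi>\<close>, while near-optimality of
      \<open>G n\<close> bounds the slope of \<open>F\<close> towards \<open>g\<close> by \<open>(1/16)^n / t n = (1/4)^n\<close>.\<close>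
    define t :: "nat \<Rightarrow> real" where "t n = (1/4) ^ n" for n
    have t: "0 < t n" "t n \<le> 1" for n
      by (auto simp: t_def power_le_one)
    define H where "H n x = (1 - t n) * G n x + t n * g x" for n x
    have H: "H n \<in> S" for n
      unfolding H_def using G that t[of n] by (intro conv) auto
    have [measurable]: "H n \<in> borel_measurable M" for n
      using H meas by blast
    define C where "C = F g - m"
    have C: "0 \<le> C" using m_le[OF that] by (simp add: C_def)
    have FH: "F (H n) \<le> m + (1/16) ^ n + t n * C" for n
    proof -
      have "F (H n) \<le> (1 - t n) * F (G n) + t n * F g"
        unfolding H_def using G that t[of n] by (intro F_conv) auto
      also have "\<dots> \<le> (1 - t n) * (m + (1/16) ^ n) + t n * F g"
        using G(2)[of n] t[of n] by (intro add_right_mono mult_left_mono) auto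
      also have "\<dots> = m + (1/16) ^ n + t n * C - t n * (1/16) ^ n"
        by (simp add: C_def algebra_simps)
      also have "\<dots> \<le> m + (1/16) ^ n + t n * C"
        using t[of n] by simp
      finally show ?thesis .
    qed
    have "AE x in M. summable (\<lambda>n. (clip (G n x) - clip (H n x))\<^sup>2)"
    proof (rule AE_summable_of_summable_integral)
      have "(\<integral>x. (clip (G n x) - clip (H n x))\<^sup>2 \<partial>M) \<le> 8 * (1/16) ^ n + 4 * C * (1/4) ^ n" for n
        using L2[OF G(1)[of n] H[of n]] G(2)[of n] FH[of n] by (simp add: t_def algebra_simps)
      then show "summable (\<lambda>n. \<integral>x. (clip (G n x) - clip (H n x))\<^sup>2 \<partial>M)"
        by (rule summable_integral_of_le) (intro summable_add summable_mult summable_geometric, auto)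
    qed (auto intro!: integrable_mult_right integrable_clip_diff_sq)
    with phi_lim have H_lim: "AE x in M. (\<lambda>n. clip (H n x)) \<longlonglongrightarrow> \<phi> x"
    proof eventually_elim
      case (elim x)
      then have "(\<lambda>n. sqrt ((clip (G n x) - clip (H n x))\<^sup>2)) \<longlonglongrightarrow> sqrt 0"
        by (intro tendsto_real_sqrt summable_LIMSEQ_zero)
      then have "(\<lambda>n. clip (G n x) - clip (H n x)) \<longlonglongrightarrow> 0"
        by (simp add: tendsto_rabs_zero_iff)
      from tendsto_diff[OF elim(1) this] show ?case by simp
    qed
    have lim: "(\<lambda>n. \<integral>x. clip (H n x) * g x \<partial>M) \<longlonglongrightarrow> (\<integral>x. \<phi> x * g x \<partial>M)"
    proof (rule integral_dominated_convergence[where w = "\<lambda>x. \<bar>g x\<bar>"])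
      show "AE x in M. (\<lambda>n. clip (H n x) * g x) \<longlonglongrightarrow> \<phi> x * g x"
        using H_lim by eventually_elim (intro tendsto_intros)
      show "AE x in M. norm (clip (H n x) * g x) \<le> \<bar>g x\<bar>" for n
        by (auto simp: abs_mult clip_bounds intro!: mult_left_le_one_le)
    qed (use int[OF that] in auto)
    \<comment> \<open>The multiplier \<open>clip (H n x)\<close> is now frozen, which makes
      \<open>p\<close> a linear functional: the derivative of \<open>F\<close> at
      \<open>H n\<close>. It is bounded below at \<open>H n\<close> itself, and its variation
      between \<open>H n\<close> and \<open>g\<close> is small.\<close>
    have "m - (1/4) ^ n \<le> (\<integral>x. clip (H n x) * g x \<partial>M)" for n
    proof -
      let ?c = "\<lambda>x. clip (H n x)"
      have int_c: "integrable M (\<lambda>x. ?c x * k x)" if "k \<in> S" for k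
        using int[OF that] by (intro integrable_unit_mult) (auto simp: clip_bounds)
      define p where "p k = (\<integral>x. ?c x * k x \<partial>M)" for k
      have pH: "p (H n) = (1 - t n) * p (G n) + t n * p g"
      proof -
        have "p (H n) = (\<integral>x. (1 - t n) * (?c x * G n x) + t n * (?c x * g x) \<partial>M)"
          unfolding p_def by (simp add: H_def algebra_simps)
        then show ?thesis
          using int_c[OF G(1)] int_c[OF that] by (simp add: p_def)
      qed
      \<comment> \<open>Gradient inequality for \<open>F\<close> at \<open>H n\<close>, obtained by
        integrating the tangent bound for \<open>huber\<close> at \<open>H n x\<close>.\<close>
      have "F (H n) + (p (G n) - p (H n)) \<le> F (G n)"
      proof -
        have "F (H n) + (p (G n) - p (H n)) = (\<integral>x. huber (H n x) + (?c x * G n x - ?c x * H n x) \<partial>M)"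
          unfolding F_def p_def using int_c[OF G(1)] int_c[OF H] integrable_huber[OF int[OF H]]
          by simp
        also have "\<dots> \<le> F (G n)"
          unfolding F_def
        proof (rule integral_mono)
          show "huber (H n x) + (?c x * G n x - ?c x * H n x) \<le> huber (G n x)" for x
            using huber_ge_affine[OF clip_bounds, of "H n x" "G n x"]
            unfolding huber_def[of "H n x"] by linarith
        qed (use int_c[OF G(1)] int_c[OF H] integrable_huber[OF int[OF H]] integrable_huber[OF int[OF G(1)]] in auto)
        finally show ?thesis .
      qed
      then have "p (G n) - p (H n) \<le> (1/16) ^ n"
        using G(2)[of n] m_le[OF H, of n] by linarith
      then have "t n * (p (G n) - p g) \<le> t n * (1/4) ^ n"
        unfolding pH by (simp add: t_def power_mult_distrib[symmetric] algebra_simps)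
      then have *: "p (G n) - p g \<le> (1/4) ^ n"
        using t(1)[of n] by (rule mult_left_le_imp_le)
      have "p (H n) - p g = (1 - t n) * (p (G n) - p g)"
        unfolding pH by (simp add: algebra_simps)
      also have "\<dots> \<le> (1 - t n) * (1/4) ^ n"
        using * t[of n] by (intro mult_left_mono) auto
      also have "\<dots> \<le> (1/4) ^ n"
        using t[of n] by (intro mult_left_le_one_le) auto
      finally have "p (H n) - p g \<le> (1/4) ^ n" .
      \<comment> \<open>Dropping the nonnegative penalty from \<open>huber\<close> leaves the linear
        functional as an upper bound for \<open>F (H n)\<close>.\<close>
      moreover have "m \<le> p (H n)"
      proof -
        have "F (H n) \<le> p (H n)"
          unfolding F_def p_def using int_c[OF H] integrable_huber[OF int[OF H]]
          by (intro integral_mono huber_le) auto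
        with m_le[OF H, of n] show ?thesis by simp
      qed
      ultimately show ?thesis
        by (simp add: p_def)
    qed
    moreover have "(\<lambda>n. m - (1/4) ^ n) \<longlonglongrightarrow> m - 0"
      by (intro tendsto_intros LIMSEQ_power_zero) auto
    ultimately show ?thesis
      using lim by (auto intro!: LIMSEQ_le[of "\<lambda>n. m - (1/4) ^ n"])
  qed
  with m0 phi_meas show ?thesis
    by (intro that[of \<phi>]) (auto simp: \<phi>_def clip_bounds intro: order_trans)
qed

end

section \<open>Sums and mixtures of measures\<close>

definition sum_measure :: "'a measure \<Rightarrow> 'a measure \<Rightarrow> 'a measure" where
  "sum_measure M N = measure_of (space M) (sets M) (\<lambda>A. emeasure M A + emeasure N A)"

lemma sets_sum_measure [simp, measurable_cong]: "sets (sum_measure M N) = sets M"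
  by (simp add: sum_measure_def)

lemma space_sum_measure [simp]: "space (sum_measure M N) = space M"
  by (simp add: sum_measure_def)

lemma emeasure_sum_measure:
  assumes "sets N = sets M" "A \<in> sets M"
  shows "emeasure (sum_measure M N) A = emeasure M A + emeasure N A"
  unfolding sum_measure_def
proof (rule emeasure_measure_of_sigma)
  show "sigma_algebra (space M) (sets M)" ..
  show "positive (sets M) (\<lambda>A. emeasure M A + emeasure N A)"
    by (simp add: positive_def)
  show "countably_additive (sets M) (\<lambda>A. emeasure M A + emeasure N A)"
  proof (rule countably_additiveI)
    fix A :: "nat \<Rightarrow> _"
    assume A: "range A \<subseteq> sets M" "disjoint_family A"
    have "(\<Sum>i. emeasure M (A i) + emeasure N (A i)) = (\<Sum>i. emeasure M (A i)) + (\<Sum>i. emeasure N (A i))"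
      by (rule suminf_add[symmetric]) auto
    with A assms show "(\<Sum>i. emeasure M (A i) + emeasure N (A i)) = emeasure M (\<Union> (range A)) + emeasure N (\<Union> (range A))"
      by (simp add: suminf_emeasure)
  qed
qed fact

lemma nn_integral_sum_measure:
  assumes sets: "sets N = sets M" and "f \<in> borel_measurable M"
  shows "(\<integral>\<^sup>+x. f x \<partial>sum_measure M N) = (\<integral>\<^sup>+x. f x \<partial>M) + (\<integral>\<^sup>+x. f x \<partial>N)"
proof -
  \<comment> \<open>The induction supplies measurability over \<open>M\<close> only; each case also
    needs it over \<open>N\<close> and over the sum.\<close>
  have cong: "g \<in> borel_measurable N" "g \<in> borel_measurable (sum_measure M N)"
    if "g \<in> borel_measurable M" for g :: "'a \<Rightarrow> ennreal"
    using that by (simp_all add: measurable_cong_sets[OF sets refl] measurable_cong_sets[OF sets_sum_measure refl])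
  show ?thesis
    using assms(2)
  proof (induction rule: borel_measurable_induct)
    case (cong f g)
    moreover have "space N = space M"
      using sets by (rule sets_eq_imp_space_eq)
    ultimately show ?case
      by (simp cong: nn_integral_cong_simp)
  next
    case (set A)
    then show ?case
      using sets by (simp add: emeasure_sum_measure)
  next
    case (mult u c)
    then show ?case
      by (simp add: cong nn_integral_cmult distrib_left)
  next
    case (add u v)
    then show ?case
      by (simp add: cong nn_integral_add ac_simps)
  next
    case (seq U)
    then have *: "U i \<in> borel_measurable N" "U i \<in> borel_measurable (sum_measure M N)" for i
      by (auto intro: cong)
    have mono: "incseq (\<lambda>i. \<integral>\<^sup>+x. U i x \<partial>M)" "incseq (\<lambda>i. \<integral>\<^sup>+x. U i x \<partial>N)"
      using seq by (auto simp: incseq_def le_fun_def intro!: nn_integral_mono)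
    have eq: "(\<integral>\<^sup>+x. (SUP i. U i) x \<partial>L) = (SUP i. \<integral>\<^sup>+x. U i x \<partial>L)" if "\<And>i. U i \<in> borel_measurable L" for L
      using nn_integral_monotone_convergence_SUP[OF \<open>incseq U\<close> that] by (simp add: image_comp)
    show ?case
      unfolding eq[OF seq(1)] eq[OF *(1)] eq[OF *(2)] seq(4)[THEN ext]
      by (subst ennreal_SUP_add[OF mono, symmetric]) (use seq in auto)
  qed
qed

lemma finite_measure_sum_measure:
  assumes "finite_measure M" "finite_measure N" "sets N = sets M"
  shows "finite_measure (sum_measure M N)"
proof
  have "space M \<in> sets N" using assms(3) by simp
  then show "emeasure (sum_measure M N) (space (sum_measure M N)) \<noteq> \<infinity>"
    using assms by (simp add: emeasure_sum_measure finite_measure.emeasure_finite)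
qed

lemma absolutely_continuous_sum_measure:
  assumes sets: "sets N = sets M"
  shows "absolutely_continuous (sum_measure M N) M" "absolutely_continuous (sum_measure M N) N"
  using sets by (auto simp: absolutely_continuous_def null_sets_def emeasure_sum_measure)

text \<open>\<open>ennreal\<close> cuts negative weights off at 0, so this is a convex combination
  only for \<open>t\<close> in [0, 1].\<close>

definition mixture :: "real \<Rightarrow> 'a measure \<Rightarrow> 'a measure \<Rightarrow> 'a measure" where
  "mixture t M N = sum_measure (scale_measure (ennreal (1 - t)) M) (scale_measure (ennreal t) N)"

lemma sets_mixture [simp, measurable_cong]: "sets (mixture t M N) = sets M"
  by (simp add: mixture_def)

lemma space_mixture [simp]: "space (mixture t M N) = space M"
  by (simp add: mixture_def space_scale_measure)

lemma emeasure_mixture: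
  assumes "sets N = sets M" "A \<in> sets M"
  shows "emeasure (mixture t M N) A = ennreal (1 - t) * emeasure M A + ennreal t * emeasure N A"
  using assms by (simp add: mixture_def emeasure_sum_measure)

lemma nn_integral_mixture:
  assumes sets: "sets N = sets M" and f: "f \<in> borel_measurable M"
  shows "(\<integral>\<^sup>+x. f x \<partial>mixture t M N) = ennreal (1 - t) * (\<integral>\<^sup>+x. f x \<partial>M) + ennreal t * (\<integral>\<^sup>+x. f x \<partial>N)"
proof -
  have "f \<in> borel_measurable N"
    using f measurable_cong_sets[OF sets refl] by auto
  then show ?thesis
    unfolding mixture_def using assms
    by (subst nn_integral_sum_measure) (simp_all add: nn_integral_scale_measure)
qed

lemma mixture_in_prob_algebra:
  assumes "M \<in> space (prob_algebra W)" "N \<in> space (prob_algebra W)" "0 \<le> t" "t \<le> 1"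
  shows "mixture t M N \<in> space (prob_algebra W)"
proof -
  have sets: "sets M = sets W" "sets N = sets W" and "prob_space M" "prob_space N"
    using assms(1,2) by (simp_all add: space_prob_algebra)
  then have "space W \<in> sets W" "space M = space W" "space N = space W"
    by (auto dest: sets_eq_imp_space_eq)
  with sets \<open>prob_space M\<close> \<open>prob_space N\<close> have "emeasure (mixture t M N) (space M) = ennreal (1 - t) + ennreal t"
    using prob_space.emeasure_space_1[of M] prob_space.emeasure_space_1[of N]
    by (subst emeasure_mixture) auto
  also have "\<dots> = 1"
    using assms(3,4) by (simp flip: ennreal_plus)
  finally show ?thesis
    using sets by (auto simp: space_prob_algebra intro!: prob_spaceI)
qed

lemma integral_mixture:
  fixes f :: "'a \<Rightarrow> real"
  assumes sets: "sets N = sets M" and t: "0 \<le> t" "t \<le> 1"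
    and M: "integrable M f" and N: "integrable N f"
  shows "integrable (mixture t M N) f"
    and "(\<integral>x. f x \<partial>mixture t M N) = (1 - t) * (\<integral>x. f x \<partial>M) + t * (\<integral>x. f x \<partial>N)"
proof -
  have [measurable]: "f \<in> borel_measurable M"
    using M by auto
  have *: "(\<integral>\<^sup>+x. h (f x) \<partial>mixture t M N) = ennreal (1 - t) * (\<integral>\<^sup>+x. h (f x) \<partial>M) + ennreal t * (\<integral>\<^sup>+x. h (f x) \<partial>N)"
    if [measurable]: "h \<in> borel_measurable borel" for h :: "real \<Rightarrow> ennreal"
    by (rule nn_integral_mixture[OF sets]) measurable
  \<comment> \<open>Linearity in the measure is known for nonnegative integrals, so \<open>f\<close>
    is split. As \<open>ennreal\<close> truncates at 0, \<open>ennreal (f x)\<close> and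
    \<open>ennreal (- f x)\<close> are its positive and negative parts.\<close>
  obtain a b where M': "0 \<le> a" "0 \<le> b" "(\<integral>\<^sup>+x. ennreal (f x) \<partial>M) = ennreal a"
    "(\<integral>\<^sup>+x. ennreal (- f x) \<partial>M) = ennreal b" "(\<integral>x. f x \<partial>M) = a - b"
    using integrableE[OF M] by metis
  obtain c d where N': "0 \<le> c" "0 \<le> d" "(\<integral>\<^sup>+x. ennreal (f x) \<partial>N) = ennreal c"
    "(\<integral>\<^sup>+x. ennreal (- f x) \<partial>N) = ennreal d" "(\<integral>x. f x \<partial>N) = c - d"
    using integrableE[OF N] by metis
  have pos: "(\<integral>\<^sup>+x. ennreal (f x) \<partial>mixture t M N) = ennreal ((1 - t) * a + t * c)"
    using M' N' t by (simp add: *[of ennreal] ennreal_plus ennreal_mult)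
  have neg: "(\<integral>\<^sup>+x. ennreal (- f x) \<partial>mixture t M N) = ennreal ((1 - t) * b + t * d)"
    using M' N' t by (simp add: *[of "\<lambda>x. ennreal (- x)"] ennreal_plus ennreal_mult)
  show int: "integrable (mixture t M N) f"
    unfolding real_integrable_def pos neg by simp
  show "(\<integral>x. f x \<partial>mixture t M N) = (1 - t) * (\<integral>x. f x \<partial>M) + t * (\<integral>x. f x \<partial>N)"
  proof -
    have "0 \<le> (1 - t) * a + t * c" "0 \<le> (1 - t) * b + t * d"
      using M' N' t by auto
    then show ?thesis
      unfolding real_lebesgue_integral_def[OF int] pos neg M'(5) N'(5)
      by simp (simp add: algebra_simps)
  qed
qed

section \<open>Convexity of the set of output measures\<close>

text \<open>Every moment is affine in the input measure, so equalities to 0 and upper bounds by 0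
  both survive mixing, and so does integrability.\<close>

lemma mixture_in_admissible_inputs:
  assumes "\<gamma> \<in> admissible_inputs W J K g1 g2" "\<gamma>' \<in> admissible_inputs W J K g1 g2" "0 \<le> t" "t \<le> 1"
  shows "mixture t \<gamma> \<gamma>' \<in> admissible_inputs W J K g1 g2"
proof -
  have \<gamma>: "\<gamma> \<in> space (prob_algebra W)" "\<gamma>' \<in> space (prob_algebra W)"
    using assms by (auto simp: admissible_inputs_def)
  then have sets: "sets \<gamma>' = sets \<gamma>"
    by (simp add: space_prob_algebra)
  note integral_mixture[OF sets assms(3,4)]
  moreover have "(1 - t) * a + t * b \<le> 0" if "a \<le> 0" "b \<le> 0" for a b
    using that assms(3,4) by (intro add_nonpos_nonpos mult_nonneg_nonpos) auto
  ultimately show ?thesis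
    using assms mixture_in_prob_algebra[OF \<gamma> assms(3,4)] by (simp add: admissible_inputs_def)
qed

text \<open>One kernel acts on all input measures, so its average over the input is affine in the
  input measure.\<close>

lemma output_operator_mixture:
  assumes \<gamma>: "\<gamma> \<in> space (prob_algebra W)" "\<gamma>' \<in> space (prob_algebra W)" "0 \<le> t" "t \<le> 1"
    and \<kappa>: "\<kappa> \<in> W \<rightarrow>\<^sub>M prob_algebra Z"
  shows "output_operator \<kappa> (mixture t \<gamma> \<gamma>') = mixture t (output_operator \<kappa> \<gamma>) (output_operator \<kappa> \<gamma>')"
proof (rule measure_eqI)
  have sets: "sets (output_operator \<kappa> \<nu>) = sets Z" if "\<nu> \<in> space (prob_algebra W)" for \<nu>
    using output_operator_in_prob_algebra[OF that \<kappa>] by (simp add: space_prob_algebra)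
  have mix: "mixture t \<gamma> \<gamma>' \<in> space (prob_algebra W)"
    using \<gamma> by (rule mixture_in_prob_algebra)
  show "sets (output_operator \<kappa> (mixture t \<gamma> \<gamma>')) = sets (mixture t (output_operator \<kappa> \<gamma>) (output_operator \<kappa> \<gamma>'))"
    using sets \<gamma>(1) mix by simp
  fix A
  assume "A \<in> sets (output_operator \<kappa> (mixture t \<gamma> \<gamma>'))"
  then have A: "A \<in> sets Z"
    using sets mix by simp
  have "(\<lambda>w. emeasure (\<kappa> w) A) \<in> borel_measurable W"
    using measurable_emeasure_kernel[OF measurable_prob_algebraD[OF \<kappa>] A] .
  then have "(\<lambda>w. emeasure (\<kappa> w) A) \<in> borel_measurable \<gamma>"
    using \<gamma>(1) by (simp add: space_prob_algebra cong: measurable_cong_sets)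
  then show "emeasure (output_operator \<kappa> (mixture t \<gamma> \<gamma>')) A =
      emeasure (mixture t (output_operator \<kappa> \<gamma>) (output_operator \<kappa> \<gamma>')) A"
    using \<gamma> A sets mix \<kappa>
    by (simp add: emeasure_mixture emeasure_output_operator nn_integral_mixture space_prob_algebra)
qed

section \<open>Densities, test functions and total variation\<close>

lemma test_function_integrable:
  assumes "\<nu> \<in> space (prob_algebra Z)" "\<phi> \<in> test_functions Z"
  shows "integrable \<nu> \<phi>"
proof -
  interpret prob_space \<nu>
    using assms(1) by (simp add: space_prob_algebra)
  have sets: "sets \<nu> = sets Z"
    using assms(1) by (simp add: space_prob_algebra)
  then have "space \<nu> = space Z"
    by (rule sets_eq_imp_space_eq)
  moreover have "\<phi> \<in> borel_measurable \<nu>"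
    using assms(2) measurable_cong_sets[OF sets refl] by (auto simp: test_functions_def)
  ultimately show ?thesis
    using assms(2) by (intro integrable_const_bound[of _ 1]) (auto simp: test_functions_def)
qed

lemma indicator_in_test_functions: "B \<in> sets Z \<Longrightarrow> indicator B \<in> test_functions Z"
  by (auto simp: test_functions_def indicator_def)

text \<open>Radon-Nikodym with a real-valued representative; integrability of \<open>f\<close>
  expresses the finite total mass of \<open>\<nu>\<close>. Only the action on test functions is
  exported, which is all that the separation argument uses.\<close>

lemma integrable_density_of_absolutely_continuous:
  assumes \<rho>: "finite_measure \<rho>" "sets \<rho> = sets Z" and \<nu>: "\<nu> \<in> space (prob_algebra Z)"
    and ac: "absolutely_continuous \<rho> \<nu>"
  obtains f :: "'a \<Rightarrow> real" where "integrable \<rho> f"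
    "\<And>\<phi>. \<phi> \<in> test_functions Z \<Longrightarrow> (\<integral>z. \<phi> z \<partial>\<nu>) = (\<integral>z. \<phi> z * f z \<partial>\<rho>)"
proof -
  interpret \<rho>: finite_measure \<rho> by fact
  interpret \<nu>: prob_space \<nu> using \<nu> by (simp add: space_prob_algebra)
  have sets: "sets \<nu> = sets \<rho>"
    using \<nu> \<rho> by (simp add: space_prob_algebra)
  obtain f where f: "f \<in> borel_measurable \<rho>" "AE x in \<rho>. RN_deriv \<rho> \<nu> x = ennreal (f x)" "\<And>x. 0 \<le> f x"
    using \<rho>.real_RN_deriv[OF \<nu>.finite_measure_axioms ac sets] by metis
  note [measurable] = f(1)
  have "density \<rho> (\<lambda>x. ennreal (f x)) = density \<rho> (RN_deriv \<rho> \<nu>)"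
    using f(2) by (intro density_cong) auto
  then have \<nu>_eq: "\<nu> = density \<rho> (\<lambda>x. ennreal (f x))"
    using \<rho>.density_RN_deriv[OF ac sets] by simp
  have "integrable (density \<rho> (\<lambda>x. ennreal (f x))) (\<lambda>_. 1::real)"
    using \<nu>.integrable_const[of "1::real"] \<nu>_eq by simp
  then have "integrable \<rho> f"
    using f(3) by (subst (asm) integrable_density) auto
  moreover have "(\<integral>z. \<phi> z \<partial>\<nu>) = (\<integral>z. \<phi> z * f z \<partial>\<rho>)" if "\<phi> \<in> test_functions Z" for \<phi>
  proof -
    have "\<phi> \<in> borel_measurable \<rho>"
      using that measurable_cong_sets[OF \<rho>(2) refl] by (auto simp: test_functions_def)
    then show ?thesis
      unfolding \<nu>_eq using f(3) by (subst integral_density) (auto simp: mult.commute)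
  qed
  ultimately show ?thesis by (rule that)
qed

lemma density_difference:
  assumes \<rho>: "finite_measure \<rho>" "sets \<rho> = sets Z"
    and "\<mu> \<in> space (prob_algebra Z)" "absolutely_continuous \<rho> \<mu>"
    and "\<nu> \<in> space (prob_algebra Z)" "absolutely_continuous \<rho> \<nu>"
  obtains g :: "'a \<Rightarrow> real" where "integrable \<rho> g"
    "\<And>\<phi>. \<phi> \<in> test_functions Z \<Longrightarrow> (\<integral>z. \<phi> z \<partial>\<mu>) - (\<integral>z. \<phi> z \<partial>\<nu>) = (\<integral>z. \<phi> z * g z \<partial>\<rho>)"
proof -
  interpret finite_measure \<rho> by fact
  obtain h where h: "integrable \<rho> h" "\<And>\<phi>. \<phi> \<in> test_functions Z \<Longrightarrow> (\<integral>z. \<phi> z \<partial>\<mu>) = (\<integral>z. \<phi> z * h z \<partial>\<rho>)"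
    using integrable_density_of_absolutely_continuous[OF \<rho> assms(3,4)] by metis
  obtain f where f: "integrable \<rho> f" "\<And>\<phi>. \<phi> \<in> test_functions Z \<Longrightarrow> (\<integral>z. \<phi> z \<partial>\<nu>) = (\<integral>z. \<phi> z * f z \<partial>\<rho>)"
    using integrable_density_of_absolutely_continuous[OF \<rho> assms(5,6)] by metis
  have "(\<integral>z. \<phi> z \<partial>\<mu>) - (\<integral>z. \<phi> z \<partial>\<nu>) = (\<integral>z. \<phi> z * (h z - f z) \<partial>\<rho>)" if "\<phi> \<in> test_functions Z" for \<phi>
  proof -
    have "\<phi> \<in> borel_measurable \<rho>" "\<And>x. x \<in> space \<rho> \<Longrightarrow> 0 \<le> \<phi> x" "\<And>x. x \<in> space \<rho> \<Longrightarrow> \<phi> x \<le> 1"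
      using that measurable_cong_sets[OF \<rho>(2) refl] sets_eq_imp_space_eq[OF \<rho>(2)]
      by (auto simp: test_functions_def)
    then have "integrable \<rho> (\<lambda>z. \<phi> z * h z)" "integrable \<rho> (\<lambda>z. \<phi> z * f z)"
      using h f by (auto intro: integrable_unit_mult)
    with h f that show ?thesis by (simp add: right_diff_distrib)
  qed
  with h f show ?thesis
    by (intro that[of "\<lambda>z. h z - f z"]) auto
qed

text \<open>With \<open>g\<close> the difference of the densities with respect to
  \<open>\<mu>\<close> plus \<open>\<nu>\<close>, the integral of \<open>\<phi> z * g z\<close> over
  [0, 1]-valued \<open>\<phi>\<close> is largest for the indicator of the set where \<open>g\<close>
  is positive, as in the Neyman-Pearson lemma. For an indicator the bound is immediate.\<close>

lemma test_function_diff_le_tv_dist: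
  assumes \<mu>: "\<mu> \<in> space (prob_algebra Z)" and \<nu>: "\<nu> \<in> space (prob_algebra Z)"
    and \<phi>: "\<phi> \<in> test_functions Z"
  shows "(\<integral>z. \<phi> z \<partial>\<mu>) - (\<integral>z. \<phi> z \<partial>\<nu>) \<le> tv_dist Z \<nu> \<mu>"
proof -
  define \<rho> where "\<rho> = sum_measure \<mu> \<nu>"
  have sets: "sets \<mu> = sets Z" "sets \<nu> = sets Z"
    using \<mu> \<nu> by (simp_all add: space_prob_algebra)
  have "prob_space \<mu>" "prob_space \<nu>"
    using \<mu> \<nu> by (simp_all add: space_prob_algebra)
  then have "finite_measure \<rho>"
    unfolding \<rho>_def using sets
    by (intro finite_measure_sum_measure) (auto dest: prob_space.finite_measure)
  then interpret finite_measure \<rho> .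
  have \<rho>: "sets \<rho> = sets Z" "space \<rho> = space Z"
    using sets by (auto simp: \<rho>_def dest: sets_eq_imp_space_eq)
  have "absolutely_continuous \<rho> \<mu>" "absolutely_continuous \<rho> \<nu>"
    unfolding \<rho>_def using sets by (simp_all add: absolutely_continuous_sum_measure)
  then obtain g where g: "integrable \<rho> g"
    "\<And>\<phi>. \<phi> \<in> test_functions Z \<Longrightarrow> (\<integral>z. \<phi> z \<partial>\<mu>) - (\<integral>z. \<phi> z \<partial>\<nu>) = (\<integral>z. \<phi> z * g z \<partial>\<rho>)"
    using density_difference[OF finite_measure_axioms \<rho>(1) \<mu> _ \<nu>] by metis
  have [measurable]: "g \<in> borel_measurable \<rho>"
    using g(1) by auto
  define B where "B = {z \<in> space \<rho>. 0 < g z}"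
  have [measurable]: "B \<in> sets \<rho>"
    unfolding B_def by measurable
  then have B: "B \<in> sets Z"
    using \<rho> by simp
  have \<phi>': "\<phi> \<in> borel_measurable \<rho>" "\<And>x. x \<in> space \<rho> \<Longrightarrow> 0 \<le> \<phi> x" "\<And>x. x \<in> space \<rho> \<Longrightarrow> \<phi> x \<le> 1"
    using \<phi> measurable_cong_sets[OF \<rho>(1) refl] \<rho>(2) by (auto simp: test_functions_def)
  have "(\<integral>z. \<phi> z \<partial>\<mu>) - (\<integral>z. \<phi> z \<partial>\<nu>) = (\<integral>z. \<phi> z * g z \<partial>\<rho>)"
    using g \<phi> by blast
  also have "\<dots> \<le> (\<integral>z. indicator B z * g z \<partial>\<rho>)"
  proof (rule integral_mono)
    show "integrable \<rho> (\<lambda>z. \<phi> z * g z)" "integrable \<rho> (\<lambda>z. indicator B z * g z)"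
      using g \<phi>' by (auto intro!: integrable_unit_mult simp: indicator_def)
    show "\<phi> z * g z \<le> indicator B z * g z" if "z \<in> space \<rho>" for z
      using \<phi>'(2,3)[OF that] that
      by (auto simp: B_def indicator_def not_less mult_left_le_one_le mult_nonneg_nonpos)
  qed
  also have "\<dots> = (\<integral>z. indicator B z \<partial>\<mu>) - (\<integral>z. indicator B z \<partial>\<nu>)"
    by (rule g(2)[OF indicator_in_test_functions[OF B], symmetric])
  also have "\<dots> = measure \<mu> B - measure \<nu> B"
    using B sets by (simp add: sets.Int_space_eq2)
  also have "\<dots> \<le> \<bar>measure \<nu> B - measure \<mu> B\<bar>"
    by simp
  also have "\<dots> \<le> tv_dist Z \<nu> \<mu>"
    unfolding tv_dist_def using B tv_dist_bdd_above[OF \<nu> \<mu>] by (rule cSUP_upper)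
  finally show ?thesis .
qed

text \<open>The absolute value can be removed because both measures have mass 1: passing to the
  complement of a set flips the sign of the difference.\<close>

lemma less_tv_distE:
  assumes \<mu>: "\<mu> \<in> space (prob_algebra Z)" and \<nu>: "\<nu> \<in> space (prob_algebra Z)"
    and less: "d < tv_dist Z \<nu> \<mu>"
  obtains B where "B \<in> sets Z" "d < measure \<mu> B - measure \<nu> B"
proof -
  have sets: "sets \<mu> = sets Z" "sets \<nu> = sets Z"
    using \<mu> \<nu> by (simp_all add: space_prob_algebra)
  interpret \<mu>: prob_space \<mu> using \<mu> by (simp add: space_prob_algebra)
  interpret \<nu>: prob_space \<nu> using \<nu> by (simp add: space_prob_algebra)
  have "sets Z \<noteq> {}" by auto
  then obtain B where B: "B \<in> sets Z" "d < \<bar>measure \<nu> B - measure \<mu> B\<bar>"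
    using less less_cSUP_iff[OF _ tv_dist_bdd_above[OF \<nu> \<mu>], of d] unfolding tv_dist_def by blast
  show ?thesis
  proof (cases "measure \<nu> B \<le> measure \<mu> B")
    case True
    with B show ?thesis by (intro that[of B]) auto
  next
    case False
    have "measure \<mu> (space Z - B) = 1 - measure \<mu> B" "measure \<nu> (space Z - B) = 1 - measure \<nu> B"
      using \<mu>.prob_compl[of B] \<nu>.prob_compl[of B] B(1) sets
      by (simp_all add: sets_eq_imp_space_eq[OF sets(1)] sets_eq_imp_space_eq[OF sets(2)])
    with False B show ?thesis by (intro that[of "space Z - B"]) auto
  qed
qed

text \<open>Reweighting \<open>\<eta>\<close> by a strictly positive integrable \<open>h\<close>
  makes it finite without creating null sets. Adding \<open>\<mu>\<close> then ensures that
  \<open>\<mu>\<close> is dominated too, which \<open>\<eta>\<close> alone need not achieve.\<close>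

lemma finite_dominating_measure:
  assumes "sigma_finite_measure \<eta>" "sets \<eta> = sets Z" "finite_measure \<mu>" "sets \<mu> = sets Z"
  obtains \<rho> where "finite_measure \<rho>" "sets \<rho> = sets Z" "absolutely_continuous \<rho> \<mu>"
    "\<And>\<nu>. absolutely_continuous \<eta> \<nu> \<Longrightarrow> absolutely_continuous \<rho> \<nu>"
proof -
  interpret sigma_finite_measure \<eta> by fact
  obtain h where h: "h \<in> borel_measurable \<eta>" "integral\<^sup>N \<eta> h \<noteq> \<infinity>" "\<And>x. x \<in> space \<eta> \<Longrightarrow> 0 < h x"
    using Ex_finite_integrable_function by metis
  define \<rho> where "\<rho> = sum_measure (density \<eta> h) \<mu>"
  have sets: "sets \<mu> = sets (density \<eta> h)"
    using assms by simp
  have "finite_measure (density \<eta> h)"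
    using h by (intro finite_measureI) (simp add: emeasure_density cong: nn_integral_cong)
  then have "finite_measure \<rho>"
    unfolding \<rho>_def using assms by (intro finite_measure_sum_measure) auto
  moreover have "sets \<rho> = sets Z" "absolutely_continuous \<rho> \<mu>"
    using assms absolutely_continuous_sum_measure[OF sets] by (auto simp: \<rho>_def)
  moreover have "absolutely_continuous \<rho> \<nu>" if "absolutely_continuous \<eta> \<nu>" for \<nu>
  proof -
    have "null_sets \<rho> \<subseteq> null_sets (density \<eta> h)"
      using absolutely_continuous_sum_measure(1)[OF sets] by (simp add: \<rho>_def absolutely_continuous_def)
    also have "\<dots> \<subseteq> null_sets \<eta>"
    proof
      fix A
      assume "A \<in> null_sets (density \<eta> h)"
      then have A: "A \<in> sets \<eta>" "AE x in \<eta>. x \<in> A \<longrightarrow> h x = 0"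
        using null_sets_density_iff[OF h(1)] by auto
      from A(2) AE_space have "AE x in \<eta>. x \<notin> A"
        by eventually_elim (use h(3) in fastforce)
      with A(1) show "A \<in> null_sets \<eta>"
        by (simp add: AE_iff_null_sets)
    qed
    finally show ?thesis
      using that by (auto simp: absolutely_continuous_def)
  qed
  ultimately show ?thesis by (rule that)
qed

section \<open>Separation of a measure from a convex set of output measures\<close>

text \<open>Positive distance only gives each \<open>\<nu>\<close> its own distinguishing set.
  Passing to density differences, \<open>uniform_test_function\<close> trades these sets for one
  test function with a gap independent of \<open>\<nu>\<close>.\<close>

proposition separating_test_function:
  fixes C :: "'z measure set"
  assumes \<mu>: "\<mu> \<in> space (prob_algebra Z)" and C: "C \<subseteq> space (prob_algebra Z)" "C \<noteq> {}"
    and conv: "\<And>\<nu> \<nu>' t. \<nu> \<in> C \<Longrightarrow> \<nu>' \<in> C \<Longrightarrow> 0 \<le> t \<Longrightarrow> t \<le> 1 \<Longrightarrow> mixture t \<nu> \<nu>' \<in> C"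
    and \<eta>: "sigma_finite_measure \<eta>" "sets \<eta> = sets Z" "\<And>\<nu>. \<nu> \<in> C \<Longrightarrow> absolutely_continuous \<eta> \<nu>"
    and not_closure: "\<mu> \<notin> tv_closure Z C"
  obtains \<phi> \<delta> where "\<phi> \<in> test_functions Z" "0 < \<delta>"
    "\<And>\<nu>. \<nu> \<in> C \<Longrightarrow> \<delta> \<le> (\<integral>z. \<phi> z \<partial>\<mu>) - (\<integral>z. \<phi> z \<partial>\<nu>)"
proof -
  interpret \<mu>: prob_space \<mu> using \<mu> by (simp add: space_prob_algebra)
  obtain \<epsilon> where \<epsilon>: "0 < \<epsilon>" "\<And>\<nu>. \<nu> \<in> C \<Longrightarrow> \<epsilon> \<le> tv_dist Z \<nu> \<mu>"
    using not_closure \<mu> by (force simp: tv_closure_def not_less)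
  \<comment> \<open>Halving makes \<open>d\<close> strictly smaller than every total variation
    distance, as \<open>less_tv_distE\<close> requires; the cap at 1 is for \<open>p \<le> 1\<close>
    below.\<close>
  define d where "d = min (\<epsilon> / 2) 1"
  have d: "0 < d" "d \<le> 1" "d < \<epsilon>"
    using \<epsilon>(1) by (auto simp: d_def)
  have sets_\<mu>: "sets \<mu> = sets Z"
    using \<mu> by (simp add: space_prob_algebra)
  obtain \<rho> where "finite_measure \<rho>" and \<rho>: "sets \<rho> = sets Z" "absolutely_continuous \<rho> \<mu>"
    "\<And>\<nu>. absolutely_continuous \<eta> \<nu> \<Longrightarrow> absolutely_continuous \<rho> \<nu>"
    by (rule finite_dominating_measure[OF \<eta>(1,2) \<mu>.finite_measure_axioms sets_\<mu>]) blast
  interpret finite_measure \<rho> by fact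
  define S where "S = {g. integrable \<rho> g \<and> (\<exists>\<nu>\<in>C. \<forall>\<phi>\<in>test_functions Z.
    (\<integral>z. \<phi> z \<partial>\<mu>) - (\<integral>z. \<phi> z \<partial>\<nu>) = (\<integral>z. \<phi> z * g z \<partial>\<rho>))}"
  have S_of: "\<exists>g\<in>S. \<forall>\<phi>\<in>test_functions Z. (\<integral>z. \<phi> z \<partial>\<mu>) - (\<integral>z. \<phi> z \<partial>\<nu>) = (\<integral>z. \<phi> z * g z \<partial>\<rho>)"
    if \<nu>: "\<nu> \<in> C" for \<nu>
  proof -
    have "\<nu> \<in> space (prob_algebra Z)"
      using \<nu> C(1) by blast
    then obtain g where "integrable \<rho> g"
      "\<And>\<phi>. \<phi> \<in> test_functions Z \<Longrightarrow> (\<integral>z. \<phi> z \<partial>\<mu>) - (\<integral>z. \<phi> z \<partial>\<nu>) = (\<integral>z. \<phi> z * g z \<partial>\<rho>)"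
      using density_difference[OF finite_measure_axioms \<rho>(1) \<mu> \<rho>(2) _ \<rho>(3)[OF \<eta>(3)[OF \<nu>]]] by blast
    with \<nu> show ?thesis
      unfolding S_def by (intro bexI[of _ g]) auto
  qed
  have test: "\<phi> \<in> borel_measurable \<rho>" "\<And>x. x \<in> space \<rho> \<Longrightarrow> 0 \<le> \<phi> x" "\<And>x. x \<in> space \<rho> \<Longrightarrow> \<phi> x \<le> 1"
    if "\<phi> \<in> test_functions Z" for \<phi>
    using that measurable_cong_sets[OF \<rho>(1) refl] sets_eq_imp_space_eq[OF \<rho>(1)]
    by (auto simp: test_functions_def)
  define R where "R = measure \<rho> (space \<rho>)"
  have R: "0 \<le> R" by (simp add: R_def)
  \<comment> \<open>The multiplier to be tested is \<open>p\<close> times the indicator of a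
    distinguishing set. It gains at least \<open>p * d\<close> and costs at most
    \<open>p\<^sup>2 / 2 * R\<close>; as \<open>p * R \<le> d\<close>, at least half of the gain
    remains.\<close>
  define p where "p = d / (1 + R)"
  have p: "0 < p" "p \<le> 1" "p * R \<le> d"
    using d R by (auto simp: p_def field_simps)
  obtain \<phi> where \<phi>: "\<phi> \<in> borel_measurable \<rho>" "\<And>x. 0 \<le> \<phi> x" "\<And>x. \<phi> x \<le> 1"
    "\<And>g. g \<in> S \<Longrightarrow> p * d / 2 \<le> (\<integral>x. \<phi> x * g x \<partial>\<rho>)"
  proof (rule uniform_test_function[of S "p * d / 2"])
    show "S \<noteq> {}" using C(2) S_of by blast
    show "integrable \<rho> g" if "g \<in> S" for g
      using that by (simp add: S_def)
    show "(\<lambda>x. (1 - t) * g x + t * h x) \<in> S" if "g \<in> S" "h \<in> S" and t: "0 \<le> t" "t \<le> 1" for g h t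
    proof -
      have g: "integrable \<rho> g" and h: "integrable \<rho> h"
        using that by (auto simp: S_def)
      obtain \<nu> where \<nu>: "\<nu> \<in> C" "\<And>\<phi>. \<phi> \<in> test_functions Z \<Longrightarrow>
          (\<integral>z. \<phi> z \<partial>\<mu>) - (\<integral>z. \<phi> z \<partial>\<nu>) = (\<integral>z. \<phi> z * g z \<partial>\<rho>)"
        using \<open>g \<in> S\<close> by (auto simp: S_def)
      obtain \<nu>' where \<nu>': "\<nu>' \<in> C" "\<And>\<phi>. \<phi> \<in> test_functions Z \<Longrightarrow>
          (\<integral>z. \<phi> z \<partial>\<mu>) - (\<integral>z. \<phi> z \<partial>\<nu>') = (\<integral>z. \<phi> z * h z \<partial>\<rho>)"
        using \<open>h \<in> S\<close> by (auto simp: S_def)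
      have prob: "\<nu> \<in> space (prob_algebra Z)" "\<nu>' \<in> space (prob_algebra Z)"
        using \<nu>(1) \<nu>'(1) C(1) by auto
      then have "sets \<nu>' = sets \<nu>"
        by (simp add: space_prob_algebra)
      have "(\<integral>z. \<phi> z \<partial>\<mu>) - (\<integral>z. \<phi> z \<partial>mixture t \<nu> \<nu>') = (\<integral>z. \<phi> z * ((1 - t) * g z + t * h z) \<partial>\<rho>)"
        if \<phi>: "\<phi> \<in> test_functions Z" for \<phi>
      proof -
        have "(\<integral>z. \<phi> z * ((1 - t) * g z + t * h z) \<partial>\<rho>) = (\<integral>z. (1 - t) * (\<phi> z * g z) + t * (\<phi> z * h z) \<partial>\<rho>)"
          by (simp add: algebra_simps)
        also have "\<dots> = (1 - t) * (\<integral>z. \<phi> z * g z \<partial>\<rho>) + t * (\<integral>z. \<phi> z * h z \<partial>\<rho>)"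
          using integrable_unit_mult[OF g test[OF \<phi>]] integrable_unit_mult[OF h test[OF \<phi>]] by simp
        also have "\<dots> = (\<integral>z. \<phi> z \<partial>\<mu>) - ((1 - t) * (\<integral>z. \<phi> z \<partial>\<nu>) + t * (\<integral>z. \<phi> z \<partial>\<nu>'))"
          unfolding \<nu>(2)[OF \<phi>, symmetric] \<nu>'(2)[OF \<phi>, symmetric] by (simp add: algebra_simps)
        also have "(1 - t) * (\<integral>z. \<phi> z \<partial>\<nu>) + t * (\<integral>z. \<phi> z \<partial>\<nu>') = (\<integral>z. \<phi> z \<partial>mixture t \<nu> \<nu>')"
          using integral_mixture(2)[OF \<open>sets \<nu>' = sets \<nu>\<close> t]
            test_function_integrable[OF prob(1) \<phi>] test_function_integrable[OF prob(2) \<phi>] by simp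
        finally show ?thesis by simp
      qed
      moreover have "mixture t \<nu> \<nu>' \<in> C"
        using \<nu>(1) \<nu>'(1) t by (rule conv)
      ultimately show ?thesis
        using g h unfolding S_def by auto
    qed
    show "p * d / 2 \<le> (\<integral>x. huber (g x) \<partial>\<rho>)" if "g \<in> S" for g
    proof -
      have g: "integrable \<rho> g"
        using that by (simp add: S_def)
      obtain \<nu> where \<nu>: "\<nu> \<in> C" "\<And>\<phi>. \<phi> \<in> test_functions Z \<Longrightarrow>
          (\<integral>z. \<phi> z \<partial>\<mu>) - (\<integral>z. \<phi> z \<partial>\<nu>) = (\<integral>z. \<phi> z * g z \<partial>\<rho>)"
        using \<open>g \<in> S\<close> by (auto simp: S_def)
      have prob: "\<nu> \<in> space (prob_algebra Z)"
        using \<nu>(1) C(1) by auto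
      have "d < tv_dist Z \<nu> \<mu>"
        using d(3) \<epsilon>(2)[OF \<nu>(1)] by simp
      then obtain B where B: "B \<in> sets Z" "d < measure \<mu> B - measure \<nu> B"
        using less_tv_distE[OF \<mu> prob] by metis
      have sets: "sets \<nu> = sets Z"
        using prob by (simp add: space_prob_algebra)
      note B_test = indicator_in_test_functions[OF B(1)]
      have "measure \<mu> B - measure \<nu> B = (\<integral>z. indicator B z * g z \<partial>\<rho>)"
        using \<nu>(2)[OF B_test] B(1) sets sets_\<mu> by (simp add: sets.Int_space_eq2)
      then have d_le: "d \<le> (\<integral>z. indicator B z * g z \<partial>\<rho>)"
        using B(2) by simp
      note int_B = integrable_unit_mult[OF g test[OF B_test]]
      have "p * d / 2 \<le> p * d - p * (p * R) / 2"
        using p mult_left_mono[of "p * R" d p] by simp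
      also have "\<dots> \<le> p * (\<integral>z. indicator B z * g z \<partial>\<rho>) - p\<^sup>2 / 2 * R"
        using mult_left_mono[OF d_le, of p] p(1) by (simp add: power2_eq_square mult.assoc)
      also have "\<dots> = (\<integral>z. p * (indicator B z * g z) - p\<^sup>2 / 2 \<partial>\<rho>)"
        using int_B by (simp add: R_def)
      also have "\<dots> \<le> (\<integral>z. huber (g z) \<partial>\<rho>)"
      proof (rule integral_mono)
        show "integrable \<rho> (\<lambda>z. p * (indicator B z * g z) - p\<^sup>2 / 2)"
          using int_B by simp
        show "integrable \<rho> (\<lambda>z. huber (g z))"
          using g by (rule integrable_huber)
        \<comment> \<open>The penalty is charged on the whole space, which is why \<open>R\<close>
          appears and not the mass of \<open>B\<close>. Outside \<open>B\<close> the left side is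
          negative and \<open>huber\<close> is nonnegative.\<close>
        show "p * (indicator B z * g z) - p\<^sup>2 / 2 \<le> huber (g z)" for z
          using huber_ge_affine[of p "g z"] p huber_nonneg[of "g z"]
          by (cases "z \<in> B") (auto intro: order_trans[of _ 0])
      qed
      finally show ?thesis .
    qed
  qed blast
  have "\<phi> \<in> borel_measurable Z"
    using \<phi>(1) measurable_cong_sets[OF \<rho>(1) refl] by auto
  then have \<phi>_test: "\<phi> \<in> test_functions Z"
    using \<phi>(2,3) by (auto simp: test_functions_def)
  show ?thesis
  proof (rule that[OF \<phi>_test])
    show "0 < p * d / 2" using p d by simp
    show "p * d / 2 \<le> (\<integral>z. \<phi> z \<partial>\<mu>) - (\<integral>z. \<phi> z \<partial>\<nu>)" if "\<nu> \<in> C" for \<nu>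
      using S_of[OF that] \<phi>(4) \<phi>_test by force
  qed
qed

section \<open>Total variation closure and the zero set of the discrepancy\<close>

text \<open>The zero test function makes the discrepancy nonnegative, so only the upper bound 0 is
  at stake. Approximating outputs give that bound; outside the closure, the uniform gap of a
  separating test function survives the infimum and refutes it.\<close>

proposition tv_closure_iff_adversarial_discrepancy:
  assumes \<mu>: "\<mu> \<in> space (prob_algebra Z)" and C: "L ` \<Gamma> \<subseteq> space (prob_algebra Z)"
    and conv: "\<And>\<nu> \<nu>' t. \<nu> \<in> L ` \<Gamma> \<Longrightarrow> \<nu>' \<in> L ` \<Gamma> \<Longrightarrow> 0 \<le> t \<Longrightarrow> t \<le> 1 \<Longrightarrow> mixture t \<nu> \<nu>' \<in> L ` \<Gamma>"
    and \<eta>: "sigma_finite_measure \<eta>" "sets \<eta> = sets Z" "\<And>\<nu>. \<nu> \<in> L ` \<Gamma> \<Longrightarrow> absolutely_continuous \<eta> \<nu>"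
  shows "\<mu> \<in> tv_closure Z (L ` \<Gamma>) \<longleftrightarrow> adversarial_discrepancy Z \<mu> \<Gamma> L = 0"
proof
  assume closure: "\<mu> \<in> tv_closure Z (L ` \<Gamma>)"
  have "adversarial_discrepancy Z \<mu> \<Gamma> L \<le> 0"
    unfolding adversarial_discrepancy_def
  proof (rule SUP_least)
    fix \<phi>
    assume \<phi>: "\<phi> \<in> test_functions Z"
    show "(INF \<gamma>\<in>\<Gamma>. ereal ((\<integral>z. \<phi> z \<partial>\<mu>) - (\<integral>z. \<phi> z \<partial>L \<gamma>))) \<le> 0"
    proof (rule ereal_le_epsilon2)
      fix e :: real
      assume "0 < e"
      then obtain \<gamma> where \<gamma>: "\<gamma> \<in> \<Gamma>" "tv_dist Z (L \<gamma>) \<mu> < e"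
        using closure by (auto simp: tv_closure_def)
      then have "(\<integral>z. \<phi> z \<partial>\<mu>) - (\<integral>z. \<phi> z \<partial>L \<gamma>) \<le> e"
        using test_function_diff_le_tv_dist[OF \<mu> _ \<phi>, of "L \<gamma>"] C by force
      with \<gamma>(1) show "(INF \<gamma>\<in>\<Gamma>. ereal ((\<integral>z. \<phi> z \<partial>\<mu>) - (\<integral>z. \<phi> z \<partial>L \<gamma>))) \<le> 0 + ereal e"
        by (auto intro: INF_lower2)
    qed
  qed
  moreover have "0 \<le> adversarial_discrepancy Z \<mu> \<Gamma> L"
    unfolding adversarial_discrepancy_def
  proof (rule SUP_upper2)
    show "(\<lambda>_. 0) \<in> test_functions Z" by (simp add: test_functions_def)
  qed (auto intro: INF_greatest)
  ultimately show "adversarial_discrepancy Z \<mu> \<Gamma> L = 0"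
    by (rule antisym)
next
  assume zero: "adversarial_discrepancy Z \<mu> \<Gamma> L = 0"
  show "\<mu> \<in> tv_closure Z (L ` \<Gamma>)"
  proof (rule ccontr)
    assume not_closure: "\<mu> \<notin> tv_closure Z (L ` \<Gamma>)"
    have "\<exists>\<phi>\<in>test_functions Z. \<exists>\<delta>>0. \<forall>\<gamma>\<in>\<Gamma>. \<delta> \<le> (\<integral>z. \<phi> z \<partial>\<mu>) - (\<integral>z. \<phi> z \<partial>L \<gamma>)"
    \<comment> \<open>Without admissible inputs the gap condition is vacuous and any test function
      will do. This is the case where the convention for the empty infimum matters: the discrepancy
      is infinite.\<close>
    proof (cases "\<Gamma> = {}")
      case True
      have "(\<lambda>_. 0) \<in> test_functions Z" by (simp add: test_functions_def)
      with True show ?thesis by (auto intro: exI[of _ "1::real"])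
    next
      case False
      then have "L ` \<Gamma> \<noteq> {}" by simp
      then obtain \<phi> \<delta> where "\<phi> \<in> test_functions Z" "0 < \<delta>"
        "\<And>\<nu>. \<nu> \<in> L ` \<Gamma> \<Longrightarrow> \<delta> \<le> (\<integral>z. \<phi> z \<partial>\<mu>) - (\<integral>z. \<phi> z \<partial>\<nu>)"
        by (rule separating_test_function[OF \<mu> C _ conv \<eta> not_closure]) blast+
      then show ?thesis
        by (intro bexI[of _ \<phi>] exI[of _ \<delta>]) auto
    qed
    then obtain \<phi> \<delta> where "\<phi> \<in> test_functions Z" and \<delta>: "0 < \<delta>"
      "\<And>\<gamma>. \<gamma> \<in> \<Gamma> \<Longrightarrow> \<delta> \<le> (\<integral>z. \<phi> z \<partial>\<mu>) - (\<integral>z. \<phi> z \<partial>L \<gamma>)"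
      by blast
    then have "ereal \<delta> \<le> adversarial_discrepancy Z \<mu> \<Gamma> L"
      unfolding adversarial_discrepancy_def by (auto intro!: SUP_upper2 INF_greatest)
    with zero \<delta>(1) show False by simp
  qed
qed

theorem theorem1:
  fixes MY :: "'y measure" and MX :: "'x measure" and MU :: "'u measure"
    and \<Theta> :: "'t set" and J :: "'j set" and K :: "'k set"
    and g1 :: "'t \<Rightarrow> 'j \<Rightarrow> 'x \<times> 'u \<Rightarrow> real"
    and g2 :: "'t \<Rightarrow> 'k \<Rightarrow> 'x \<times> 'u \<Rightarrow> real"
    and \<kappa> :: "'t \<Rightarrow> 'x \<times> 'u \<Rightarrow> ('y \<times> 'x) measure"
    and \<Gamma> :: "'t \<Rightarrow> ('x \<times> 'u) measure set"
    and L :: "'t \<Rightarrow> ('x \<times> 'u) measure \<Rightarrow> ('y \<times> 'x) measure"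
    and \<mu> :: "('y \<times> 'x) measure"
  assumes g1_measurable:
      "\<And>\<theta> j. \<theta> \<in> \<Theta> \<Longrightarrow> j \<in> J \<Longrightarrow> g1 \<theta> j \<in> borel_measurable (MX \<Otimes>\<^sub>M MU)"
    and g2_measurable:
      "\<And>\<theta> k. \<theta> \<in> \<Theta> \<Longrightarrow> k \<in> K \<Longrightarrow> g2 \<theta> k \<in> borel_measurable (MX \<Otimes>\<^sub>M MU)"
    and \<Gamma>_eq:
      "\<And>\<theta>. \<theta> \<in> \<Theta> \<Longrightarrow> \<Gamma> \<theta> = admissible_inputs (MX \<Otimes>\<^sub>M MU) J K (g1 \<theta>) (g2 \<theta>)"
    and kernel:
      "\<And>\<theta>. \<theta> \<in> \<Theta> \<Longrightarrow> \<kappa> \<theta> \<in> (MX \<Otimes>\<^sub>M MU) \<rightarrow>\<^sub>M prob_algebra (MY \<Otimes>\<^sub>M MX)"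
    and kernel_proj:
      "\<And>\<theta> x u. \<theta> \<in> \<Theta> \<Longrightarrow> x \<in> space MX \<Longrightarrow> u \<in> space MU \<Longrightarrow>
         distr (\<kappa> \<theta> (x, u)) MX snd = return MX x"
    and L_eq:
      "\<And>\<theta>. \<theta> \<in> \<Theta> \<Longrightarrow> L \<theta> = output_operator (\<kappa> \<theta>)"
    and dominated:
      "\<And>\<theta>. \<theta> \<in> \<Theta> \<Longrightarrow>
         \<exists>\<nu>. sets \<nu> = sets (MY \<Otimes>\<^sub>M MX) \<and> sigma_finite_measure \<nu> \<and>
             (\<forall>\<gamma>\<in>\<Gamma> \<theta>. absolutely_continuous \<nu> (L \<theta> \<gamma>))"
    and \<mu>_prob: "\<mu> \<in> space (prob_algebra (MY \<Otimes>\<^sub>M MX))"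
  shows "{\<theta> \<in> \<Theta>. \<mu> \<in> tv_closure (MY \<Otimes>\<^sub>M MX) (L \<theta> ` \<Gamma> \<theta>)} =
         {\<theta> \<in> \<Theta>. adversarial_discrepancy (MY \<Otimes>\<^sub>M MX) \<mu> (\<Gamma> \<theta>) (L \<theta>) = 0}"
proof (intro Collect_cong conj_cong refl)
  fix \<theta>
  assume \<theta>: "\<theta> \<in> \<Theta>"
  let ?W = "MX \<Otimes>\<^sub>M MU" and ?Z = "MY \<Otimes>\<^sub>M MX"
  obtain \<eta> where \<eta>: "sigma_finite_measure \<eta>" "sets \<eta> = sets ?Z"
    "\<And>\<gamma>. \<gamma> \<in> \<Gamma> \<theta> \<Longrightarrow> absolutely_continuous \<eta> (L \<theta> \<gamma>)"
    using dominated[OF \<theta>] by blast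
  have prob: "\<gamma> \<in> space (prob_algebra ?W)" if "\<gamma> \<in> \<Gamma> \<theta>" for \<gamma>
    using that \<Gamma>_eq[OF \<theta>] by (simp add: admissible_inputs_def)
  show "\<mu> \<in> tv_closure ?Z (L \<theta> ` \<Gamma> \<theta>) \<longleftrightarrow> adversarial_discrepancy ?Z \<mu> (\<Gamma> \<theta>) (L \<theta>) = 0"
  proof (rule tv_closure_iff_adversarial_discrepancy[OF \<mu>_prob _ _ \<eta>(1,2)])
    show "L \<theta> ` \<Gamma> \<theta> \<subseteq> space (prob_algebra ?Z)"
      using prob kernel[OF \<theta>] by (auto simp: L_eq[OF \<theta>] intro: output_operator_in_prob_algebra)
    show "mixture t \<nu> \<nu>' \<in> L \<theta> ` \<Gamma> \<theta>"
      if \<nu>: "\<nu> \<in> L \<theta> ` \<Gamma> \<theta>" "\<nu>' \<in> L \<theta> ` \<Gamma> \<theta>" and t: "0 \<le> t" "t \<le> 1" for \<nu> \<nu>' t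
    proof -
      obtain \<gamma> \<gamma>' where \<gamma>: "\<gamma> \<in> \<Gamma> \<theta>" "\<gamma>' \<in> \<Gamma> \<theta>" "\<nu> = L \<theta> \<gamma>" "\<nu>' = L \<theta> \<gamma>'"
        using \<nu> by blast
      \<comment> \<open>Mixing outputs amounts to mixing inputs, so convexity passes from the
        admissible inputs to their image.\<close>
      then have "mixture t \<nu> \<nu>' = L \<theta> (mixture t \<gamma> \<gamma>')"
        using output_operator_mixture[OF prob prob t kernel[OF \<theta>]] by (simp add: L_eq[OF \<theta>])
      moreover have "mixture t \<gamma> \<gamma>' \<in> \<Gamma> \<theta>"
        using \<gamma>(1,2) t unfolding \<Gamma>_eq[OF \<theta>] by (rule mixture_in_admissible_inputs)
      ultimately show ?thesis by blast
    qed
  qed (use \<eta>(3) in blast)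
qed

end
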